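(* Let $P=\mathbb{C}[x_{ijk} : i,j,k\in\{0,1\}]$ with the action of $SL_2(\mathbb{C})\times SL_2(\mathbb{C})\times SL_2(\mathbb{C})$ by changes of basis of determinant $1$ along the three directions of the array $(x_{ijk})$, and let $P_4$ be the space of homogeneous polynomials of degree $4$ in $P$. The space of invariant polynomials in $P_4$ has dimension $1$ over $\mathbb{C}$, and every invariant polynomial in $P_4$ is a scalar multiple of Cayley's hyperdeterminant $C$.
   Context: The group $SL_2(\mathbb{C})^3$ acts on $P=\mathbb{C}[x_{ijk}: i,j,k\in\{0,1\}]$ by $\mathbb{C}$-algebra automorphisms: identifying $x_{ijk}$ with the simple tensor $x_i\otimes x_j\otimes x_k\in\mathbb{C}^2\otimes\mathbb{C}^2\otimes\mathbb{C}^2$ (where $x_0,x_1$ is the standard basis of $\mathbb{C}^2$, with $SL_2(\mathbb{C})$ acting by matrix-vector multiplication), a triple $(A,B,D)$ with $A=(a_{pq})$, $B=(b_{pq})$, $D=(d_{pq})$ ($p,q\in\{0,1\}$) sends $x_{ijk}\mapsto\sum_{i',j',k'\in\{0,1\}}a_{i'i}\,b_{j'j}\,d_{k'k}\,x_{i'j'k'}$, and this is extended multiplicatively and linearly to $P$. A polynomial $f\in P$ is invariant if $(A,B,D)\cdot f=f$ for all $(A,B,D)\in SL_2(\mathbb{C})^3$. Cayley's hyperdeterminant is \begin{align*} C={}&x_{000}^2x_{111}^2+x_{001}^2x_{110}^2+x_{010}^2x_{101}^2+x_{011}^2x_{100}^2\\ &-2\big(x_{000}x_{001}x_{110}x_{111}+x_{000}x_{010}x_{101}x_{111}+x_{000}x_{011}x_{100}x_{111}\\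 &\qquad+x_{001}x_{010}x_{101}x_{110}+x_{001}x_{011}x_{100}x_{110}+x_{010}x_{011}x_{100}x_{101}\big)\\ &+4\big(x_{000}x_{011}x_{101}x_{110}+x_{001}x_{010}x_{100}x_{111}\big). \end{align*} *)

theory Defs
  imports "HOL-Analysis.Analysis" "HOL-Library.Poly_Mapping"
begin

text \<open>
  A polynomial in variables indexed by \<open>'v\<close> is a finitely supported function from exponent
  vectors to coefficients; the multiplication on \<open>\<Rightarrow>\<^sub>0\<close> is the convolution product.
  The indices 0, 1 are the two elements of the numeral type \<open>2\<close> (where the numeral 2 denotes 0).
\<close>

type_synonym 'v cpoly = "('v \<Rightarrow>\<^sub>0 nat) \<Rightarrow>\<^sub>0 complex"

type_synonym array_poly = "(2 \<times> 2 \<times> 2) cpoly"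

definition smult_cpoly :: "complex \<Rightarrow> 'v cpoly \<Rightarrow> 'v cpoly" where
  "smult_cpoly c f = Poly_Mapping.single 0 c * f"

interpretation cpoly: vector_space smult_cpoly
  by unfold_locales
    (simp_all add: smult_cpoly_def algebra_simps single_add mult_single single_one)

definition var :: "'v \<Rightarrow> 'v cpoly" where
  "var v = Poly_Mapping.single (Poly_Mapping.single v 1) 1"

abbreviation X :: "2 \<Rightarrow> 2 \<Rightarrow> 2 \<Rightarrow> array_poly" where
  "X i j k \<equiv> var (i, j, k)"

text \<open>
  The \<open>\<complex>\<close>-algebra endomorphism determined by its values \<open>\<sigma> v\<close> on the variables.
\<close>

definition psubst :: "('v::finite \<Rightarrow> 'v cpoly) \<Rightarrow> 'v cpoly \<Rightarrow> 'v cpoly" where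
  "psubst \<sigma> f = (\<Sum>m\<in>Poly_Mapping.keys f.
     smult_cpoly (Poly_Mapping.lookup f m) (\<Prod>v\<in>UNIV. \<sigma> v ^ Poly_Mapping.lookup m v))"

lemma psubst_alt:
  assumes "finite S" "Poly_Mapping.keys f \<subseteq> S"
  shows "psubst \<sigma> f = (\<Sum>m\<in>S.
     smult_cpoly (Poly_Mapping.lookup f m) (\<Prod>v\<in>UNIV. \<sigma> v ^ Poly_Mapping.lookup m v))"
  unfolding psubst_def using assms
  by (intro sum.mono_neutral_left) (auto simp: in_keys_iff)

lemma psubst_add: "psubst \<sigma> (f + g) = psubst \<sigma> f + psubst \<sigma> g"
proof -
  let ?S = "Poly_Mapping.keys f \<union> Poly_Mapping.keys g"
  have "psubst \<sigma> h = (\<Sum>m\<in>?S.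
     smult_cpoly (Poly_Mapping.lookup h m) (\<Prod>v\<in>UNIV. \<sigma> v ^ Poly_Mapping.lookup m v))"
    if "h \<in> {f, g, f + g}" for h
    using that keys_add[of f g] by (intro psubst_alt) auto
  then show ?thesis
    by (simp add: lookup_add cpoly.scale_left_distrib sum.distrib)
qed

lemma psubst_single:
  "psubst \<sigma> (Poly_Mapping.single m c) = smult_cpoly c (\<Prod>v\<in>UNIV. \<sigma> v ^ Poly_Mapping.lookup m v)"
  by (subst psubst_alt[of "{m}"]) (auto split: if_splits)

lemma psubst_zero: "psubst \<sigma> 0 = 0"
  by (simp add: psubst_def)

lemma psubst_one: "psubst \<sigma> 1 = 1"
  using psubst_single[of \<sigma> 0 1] by (simp add: single_one)

lemma psubst_var: "psubst \<sigma> (var v) = \<sigma> v"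
proof -
  have "(\<Prod>w\<in>UNIV. \<sigma> w ^ Poly_Mapping.lookup (Poly_Mapping.single v 1) w)
      = (\<Prod>w\<in>UNIV. if w = v then \<sigma> w else 1)"
    by (intro prod.cong) (auto simp: lookup_single when_def)
  then show ?thesis
    by (simp add: var_def psubst_single)
qed

lemma cpoly_induct [case_names zero single add]:
  fixes f :: "'v cpoly"
  assumes "P 0" "\<And>m c. P (Poly_Mapping.single m c)" "\<And>f g. P f \<Longrightarrow> P g \<Longrightarrow> P (f + g)"
  shows "P f"
proof -
  have "P (\<Sum>m\<in>S. Poly_Mapping.single m (Poly_Mapping.lookup f m))" if "finite S" for S
    using that by (induction S) (auto intro: assms)
  from this[of "Poly_Mapping.keys f"]
  have "P (\<Sum>m\<in>Poly_Mapping.keys f. Poly_Mapping.single m (Poly_Mapping.lookup f m))"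
    by simp
  also have "(\<Sum>m\<in>Poly_Mapping.keys f. Poly_Mapping.single m (Poly_Mapping.lookup f m)) = f"
    by (rule poly_mapping_eqI)
      (auto simp: lookup_sum lookup_single when_def in_keys_iff sum.delta)
  finally show ?thesis .
qed

lemma psubst_mult: "psubst \<sigma> (f * g) = psubst \<sigma> f * psubst \<sigma> g"
proof (induction f rule: cpoly_induct)
  case (single m c)
  show ?case
  proof (induction g rule: cpoly_induct)
    case (single m' c')
    have "Poly_Mapping.single 0 (c * c')
        = (Poly_Mapping.single 0 c * Poly_Mapping.single 0 c' :: 'a cpoly)"
      by (simp add: mult_single)
    moreover have "Poly_Mapping.single m c * Poly_Mapping.single m' c'
        = Poly_Mapping.single (m + m') (c * c')"
      by (simp add: mult_single)
    ultimately show ?case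
      by (simp add: psubst_single smult_cpoly_def lookup_add power_add prod.distrib mult_ac)
  qed (simp_all add: psubst_zero psubst_add algebra_simps)
qed (simp_all add: psubst_zero psubst_add algebra_simps)

lemma psubst_smult: "psubst \<sigma> (smult_cpoly c f) = smult_cpoly c (psubst \<sigma> f)"
  by (simp add: smult_cpoly_def psubst_mult psubst_single)

definition homogeneous :: "nat \<Rightarrow> 'v::finite cpoly set" where
  "homogeneous d = {f. \<forall>m\<in>Poly_Mapping.keys f. (\<Sum>v\<in>UNIV. Poly_Mapping.lookup m v) = d}"

definition SL2 :: "(complex^2^2) set" where
  "SL2 = {A. det A = 1}"

definition act :: "complex^2^2 \<Rightarrow> complex^2^2 \<Rightarrow> complex^2^2 \<Rightarrow> array_poly \<Rightarrow> array_poly" where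
  "act A B D = psubst (\<lambda>(i, j, k). \<Sum>i'\<in>UNIV. \<Sum>j'\<in>UNIV. \<Sum>k'\<in>UNIV.
     smult_cpoly (A $ i' $ i * B $ j' $ j * D $ k' $ k) (X i' j' k'))"

definition invariants :: "array_poly set" where
  "invariants = {f. \<forall>A\<in>SL2. \<forall>B\<in>SL2. \<forall>D\<in>SL2. act A B D f = f}"

lemma act_var:
  "act A B D (X i j k) = (\<Sum>i'\<in>UNIV. \<Sum>j'\<in>UNIV. \<Sum>k'\<in>UNIV.
     smult_cpoly (A $ i' $ i * B $ j' $ j * D $ k' $ k) (X i' j' k'))"
  by (simp add: act_def psubst_var)

lemma subspace_invariants_homogeneous: "cpoly.subspace (invariants \<inter> homogeneous d)"
proof (rule cpoly.subspaceI)
  show "0 \<in> invariants \<inter> homogeneous d"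
    by (simp add: invariants_def homogeneous_def act_def psubst_zero)
next
  fix f g assume "f \<in> invariants \<inter> homogeneous d" "g \<in> invariants \<inter> homogeneous d"
  then show "f + g \<in> invariants \<inter> homogeneous d"
    using keys_add[of f g] by (auto simp: invariants_def homogeneous_def act_def psubst_add)
next
  fix c f assume "f \<in> invariants \<inter> homogeneous d"
  moreover have "Poly_Mapping.keys (smult_cpoly c f) \<subseteq> Poly_Mapping.keys f"
    unfolding smult_cpoly_def using keys_mult[of "Poly_Mapping.single 0 c" f]
    by (auto split: if_splits)
  ultimately show "smult_cpoly c f \<in> invariants \<inter> homogeneous d"
    by (auto simp: invariants_def homogeneous_def act_def psubst_smult)
qed

definition hyperdet :: array_poly where
  "hyperdet =
     (X 0 0 0)^2 * (X 1 1 1)^2 + (X 0 0 1)^2 * (X 1 1 0)^2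
   + (X 0 1 0)^2 * (X 1 0 1)^2 + (X 0 1 1)^2 * (X 1 0 0)^2
   - 2 * (X 0 0 0 * X 0 0 1 * X 1 1 0 * X 1 1 1 + X 0 0 0 * X 0 1 0 * X 1 0 1 * X 1 1 1
        + X 0 0 0 * X 0 1 1 * X 1 0 0 * X 1 1 1 + X 0 0 1 * X 0 1 0 * X 1 0 1 * X 1 1 0
        + X 0 0 1 * X 0 1 1 * X 1 0 0 * X 1 1 0 + X 0 1 0 * X 0 1 1 * X 1 0 0 * X 1 0 1)
   + 4 * (X 0 0 0 * X 0 1 1 * X 1 0 1 * X 1 1 0 + X 0 0 1 * X 0 1 0 * X 1 0 0 * X 1 1 1)"

end

theory Submission
  imports Defs
begin

text \<open>
  Existence: the first index of the array \<open>x\<close> makes it a matrix with two rows and four columns.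
  Cayley's form is a polynomial in the maximal minors of this matrix, namely the discriminant of
  the binary quadratic form \<open>det (s M\<^sub>0 + t M\<^sub>1)\<close>, where \<open>M\<^sub>0, M\<^sub>1\<close> are the two slices with
  last index 0 and 1 (\<open>hyperdet_form_minors\<close>). A change of basis along the first direction multiplies
  every minor by its determinant, so it fixes the form if the determinant is 1. The form is symmetric
  in the three directions, which gives the other two factors of the group.

  Uniqueness: the diagonal matrices force every monomial of an invariant quartic to have degree 2
  in the variables of each of the six faces of the cube. There are only twelve such monomials
  (\<open>keys_invariant_balanced\<close>): the squares \<open>x\<^sub>v\<^sup>2 x\<^sub>w\<^sup>2\<close> for the four pairs of antipodal vertices
  \<open>v, w\<close>, the products of two different antipodal pairs, and the products over the two inscribed
  tetrahedra. Shear matrices relate the twelve coefficients: comparing the values of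
  the quartic at an array and at its shear expresses all of them through the coefficient of
  \<open>x\<^sub>0\<^sub>0\<^sub>0\<^sup>2 x\<^sub>1\<^sub>1\<^sub>1\<^sup>2\<close>. That coefficient is the value at the array \<open>e\<^sub>0\<^sub>0\<^sub>0 + e\<^sub>1\<^sub>1\<^sub>1\<close>, so an invariant
  quartic that vanishes at this array is zero (\<open>invariant_quartic_eq_0\<close>). Cayley's form has the value
  1 there. For an invariant quartic \<open>f\<close>, the difference \<open>f - f(e\<^sub>0\<^sub>0\<^sub>0 + e\<^sub>1\<^sub>1\<^sub>1) C\<close> is an invariant
  quartic that vanishes at this array, so it is zero.
\<close>

section \<open>Arrays of format 2 x 2 x 2\<close>

lemma UNIV_2_01: "(UNIV :: 2 set) = {0, 1}"
proof -
  have "(2 :: 2) = 0" by simp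
  then show ?thesis using UNIV_2 by auto
qed

lemma sum_2_01: "(\<Sum>i\<in>(UNIV :: 2 set). f i) = f 0 + f 1"
  by (simp add: UNIV_2_01)

lemma prod_2_01: "(\<Prod>i\<in>(UNIV :: 2 set). f i) = f 0 * f 1"
  by (simp add: UNIV_2_01)

lemma forall_2_01: "(\<forall>i :: 2. P i) \<longleftrightarrow> P 0 \<and> P 1"
  using UNIV_2_01 by (metis UNIV_I insertE singletonD)

lemma sum_array:
  "(\<Sum>v\<in>(UNIV :: (2 \<times> 2 \<times> 2) set). f v) =
     (\<Sum>i\<in>UNIV. \<Sum>j\<in>UNIV. \<Sum>k\<in>UNIV. f (i, j, k))"
  by (simp add: sum.cartesian_product flip: UNIV_Times_UNIV)

lemma prod_array:
  "(\<Prod>v\<in>(UNIV :: (2 \<times> 2 \<times> 2) set). f v) =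
     (\<Prod>i\<in>UNIV. \<Prod>j\<in>UNIV. \<Prod>k\<in>UNIV. f (i, j, k))"
  by (simp add: prod.cartesian_product flip: UNIV_Times_UNIV)

definition array :: "'a \<Rightarrow> 'a \<Rightarrow> 'a \<Rightarrow> 'a \<Rightarrow> 'a \<Rightarrow> 'a \<Rightarrow> 'a \<Rightarrow> 'a \<Rightarrow> 2 \<times> 2 \<times> 2 \<Rightarrow> 'a" where
  "array x000 x001 x010 x011 x100 x101 x110 x111 = (\<lambda>(i, j, k).
     if i = 0 then if j = 0 then if k = 0 then x000 else x001 else if k = 0 then x010 else x011
     else if j = 0 then if k = 0 then x100 else x101 else if k = 0 then x110 else x111)"

lemma array_simps [simp]:
  "array a b c d e f g h (0, 0, 0) = a" "array a b c d e f g h (0, 0, 1) = b"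
  "array a b c d e f g h (0, 1, 0) = c" "array a b c d e f g h (0, 1, 1) = d"
  "array a b c d e f g h (1, 0, 0) = e" "array a b c d e f g h (1, 0, 1) = f"
  "array a b c d e f g h (1, 1, 0) = g" "array a b c d e f g h (1, 1, 1) = h"
  by (simp_all add: array_def)

lemma array_eqI:
  fixes x y :: "2 \<times> 2 \<times> 2 \<Rightarrow> 'a"
  assumes "x (0, 0, 0) = y (0, 0, 0)" "x (0, 0, 1) = y (0, 0, 1)"
    "x (0, 1, 0) = y (0, 1, 0)" "x (0, 1, 1) = y (0, 1, 1)"
    "x (1, 0, 0) = y (1, 0, 0)" "x (1, 0, 1) = y (1, 0, 1)"
    "x (1, 1, 0) = y (1, 1, 0)" "x (1, 1, 1) = y (1, 1, 1)"
  shows "x = y"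
proof -
  have "\<forall>i j k. x (i, j, k) = y (i, j, k)"
    using assms by (simp add: forall_2_01)
  then show ?thesis by auto
qed

lemma array_inject:
  "array a b c d e f g h = array a' b' c' d' e' f' g' h' \<longleftrightarrow>
     a = a' \<and> b = b' \<and> c = c' \<and> d = d' \<and> e = e' \<and> f = f' \<and> g = g' \<and> h = h'"
  by (metis array_simps)

text \<open>
  Changes of basis along one direction. The entries may lie in any commutative ring, so that the
  same operation serves for arrays of numbers and for the array of variables. The group acts on
  variables by columns of the matrix, so the summation runs over the first index of \<open>M\<close>.
\<close>

definition mix1 :: "(2 \<Rightarrow> 2 \<Rightarrow> 'a::comm_ring_1) \<Rightarrow> (2 \<times> 2 \<times> 2 \<Rightarrow> 'a) \<Rightarrow> 2 \<times> 2 \<times> 2 \<Rightarrow> 'a" where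
  "mix1 M x = (\<lambda>(i, j, k). \<Sum>p\<in>UNIV. M p i * x (p, j, k))"

definition mix2 :: "(2 \<Rightarrow> 2 \<Rightarrow> 'a::comm_ring_1) \<Rightarrow> (2 \<times> 2 \<times> 2 \<Rightarrow> 'a) \<Rightarrow> 2 \<times> 2 \<times> 2 \<Rightarrow> 'a" where
  "mix2 M x = (\<lambda>(i, j, k). \<Sum>p\<in>UNIV. M p j * x (i, p, k))"

definition mix3 :: "(2 \<Rightarrow> 2 \<Rightarrow> 'a::comm_ring_1) \<Rightarrow> (2 \<times> 2 \<times> 2 \<Rightarrow> 'a) \<Rightarrow> 2 \<times> 2 \<times> 2 \<Rightarrow> 'a" where
  "mix3 M x = (\<lambda>(i, j, k). \<Sum>p\<in>UNIV. M p k * x (i, j, p))"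

section \<open>The hyperdeterminant as a form on arrays over a commutative ring\<close>

definition hyperdet_form :: "(2 \<times> 2 \<times> 2 \<Rightarrow> 'a::comm_ring_1) \<Rightarrow> 'a" where
  "hyperdet_form x =
     (x (0,0,0))^2 * (x (1,1,1))^2 + (x (0,0,1))^2 * (x (1,1,0))^2
   + (x (0,1,0))^2 * (x (1,0,1))^2 + (x (0,1,1))^2 * (x (1,0,0))^2
   - 2 * (x (0,0,0) * x (0,0,1) * x (1,1,0) * x (1,1,1)
        + x (0,0,0) * x (0,1,0) * x (1,0,1) * x (1,1,1)
        + x (0,0,0) * x (0,1,1) * x (1,0,0) * x (1,1,1)
        + x (0,0,1) * x (0,1,0) * x (1,0,1) * x (1,1,0)
        + x (0,0,1) * x (0,1,1) * x (1,0,0) * x (1,1,0)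
        + x (0,1,0) * x (0,1,1) * x (1,0,0) * x (1,0,1))
   + 4 * (x (0,0,0) * x (0,1,1) * x (1,0,1) * x (1,1,0)
        + x (0,0,1) * x (0,1,0) * x (1,0,0) * x (1,1,1))"

text \<open>The maximal minors of the array read as a matrix whose rows are given by the first index.\<close>

definition minor :: "(2 \<times> 2 \<times> 2 \<Rightarrow> 'a::comm_ring_1) \<Rightarrow> 2 \<times> 2 \<Rightarrow> 2 \<times> 2 \<Rightarrow> 'a" where
  "minor x u w = x (0, u) * x (1, w) - x (1, u) * x (0, w)"

text \<open>
  The right-hand side is the discriminant in \<open>s, t\<close> of
  \<open>det (s M\<^sub>0 + t M\<^sub>1)\<close>, whose three coefficients are sums of minors. In this shape the effect of a
  change of basis along the first direction is visible without expanding the quartic.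
\<close>

lemma hyperdet_form_minors:
  "hyperdet_form x =
     (minor x (0,0) (1,1) + minor x (0,1) (1,0))^2 - 4 * minor x (0,0) (1,0) * minor x (0,1) (1,1)"
  unfolding hyperdet_form_def minor_def by (simp add: algebra_simps power2_eq_square)

lemma minor_mix1:
  "minor (mix1 M x) u w = (M 0 0 * M 1 1 - M 0 1 * M 1 0) * minor x u w"
  by (cases u; cases w) (simp add: minor_def mix1_def sum_2_01 algebra_simps)

lemma hyperdet_form_mix1:
  assumes "M 0 0 * M 1 1 - M 0 1 * M 1 0 = 1"
  shows "hyperdet_form (mix1 M x) = hyperdet_form x"
  using assms by (simp add: hyperdet_form_minors minor_mix1)

lemma hyperdet_form_swap12: "hyperdet_form (\<lambda>(i, j, k). x (j, i, k)) = hyperdet_form x"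
  by (simp add: hyperdet_form_def algebra_simps)

lemma hyperdet_form_swap13: "hyperdet_form (\<lambda>(i, j, k). x (k, j, i)) = hyperdet_form x"
  by (simp add: hyperdet_form_def algebra_simps)

lemma hyperdet_form_mix2:
  assumes "M 0 0 * M 1 1 - M 0 1 * M 1 0 = 1"
  shows "hyperdet_form (mix2 M x) = hyperdet_form x"
proof -
  have "mix2 M x = (\<lambda>(i, j, k). mix1 M (\<lambda>(i, j, k). x (j, i, k)) (j, i, k))"
    by (simp add: mix1_def mix2_def)
  then show ?thesis
    using assms by (simp add: hyperdet_form_swap12 hyperdet_form_mix1)
qed

lemma hyperdet_form_mix3:
  assumes "M 0 0 * M 1 1 - M 0 1 * M 1 0 = 1"
  shows "hyperdet_form (mix3 M x) = hyperdet_form x"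
proof -
  have "mix3 M x = (\<lambda>(i, j, k). mix1 M (\<lambda>(i, j, k). x (k, j, i)) (k, j, i))"
    by (simp add: mix1_def mix3_def)
  then show ?thesis
    using assms by (simp add: hyperdet_form_swap13 hyperdet_form_mix1)
qed

section \<open>Substitution and evaluation of polynomials\<close>

abbreviation const :: "complex \<Rightarrow> 'v cpoly" where
  "const c \<equiv> Poly_Mapping.single 0 c"

lemma const_mult: "const (a * b) = (const a * const b :: 'v cpoly)"
  by (simp add: mult_single)

lemma const_diff: "const (a - b) = (const a - const b :: 'v cpoly)"
  by (rule single_diff)

lemma const_sum: "const (\<Sum>a\<in>S. h a) = (\<Sum>a\<in>S. const (h a) :: 'v cpoly)"
  by (induction S rule: infinite_finite_induct) (simp_all add: single_add)

lemma const_power: "const (a ^ n) = (const a ^ n :: 'v cpoly)"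
  by (induction n) (simp_all add: const_mult single_one)

lemma const_prod: "const (\<Prod>a\<in>S. h a) = (\<Prod>a\<in>S. const (h a) :: 'v cpoly)"
  by (induction S rule: infinite_finite_induct) (simp_all add: const_mult single_one)

lemma const_inject [simp]: "(const a :: 'v cpoly) = const b \<longleftrightarrow> a = b"
  by (metis lookup_single_eq)

lemma psubst_diff: "psubst \<sigma> (f - g) = psubst \<sigma> f - psubst \<sigma> g"
  using psubst_add[of \<sigma> "f - g" g] by (simp add: algebra_simps)

lemma psubst_sum: "psubst \<sigma> (\<Sum>a\<in>S. h a) = (\<Sum>a\<in>S. psubst \<sigma> (h a))"
  by (induction S rule: infinite_finite_induct) (simp_all add: psubst_zero psubst_add)

lemma psubst_power: "psubst \<sigma> (f ^ n) = psubst \<sigma> f ^ n"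
  by (induction n) (simp_all add: psubst_one psubst_mult)

lemma psubst_prod: "psubst \<sigma> (\<Prod>a\<in>S. h a) = (\<Prod>a\<in>S. psubst \<sigma> (h a))"
  by (induction S rule: infinite_finite_induct) (simp_all add: psubst_one psubst_mult)

lemma psubst_numeral: "psubst \<sigma> (numeral n) = numeral n"
  by (induction n) (simp_all only: numeral.simps psubst_one psubst_add)

lemma psubst_const: "psubst \<sigma> (const c) = const c"
  by (simp add: psubst_single smult_cpoly_def)

lemma psubst_psubst: "psubst \<tau> (psubst \<sigma> f) = psubst (\<lambda>v. psubst \<tau> (\<sigma> v)) f"
  by (induction f rule: cpoly_induct)
    (simp_all add: psubst_zero psubst_add psubst_single psubst_smult psubst_prod psubst_power)

text \<open>
  Evaluation at a point is substitution of constants (\<open>psubst_const_eq_peval\<close>); its homomorphism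
  properties are transferred from substitution by the injectivity of \<open>const\<close>.
\<close>

definition peval :: "('v::finite \<Rightarrow> complex) \<Rightarrow> 'v cpoly \<Rightarrow> complex" where
  "peval x f = (\<Sum>m\<in>Poly_Mapping.keys f.
     Poly_Mapping.lookup f m * (\<Prod>v\<in>UNIV. x v ^ Poly_Mapping.lookup m v))"

lemma psubst_const_eq_peval: "psubst (\<lambda>v. const (x v)) f = const (peval x f)"
  by (simp add: psubst_def peval_def smult_cpoly_def const_sum const_mult const_prod const_power)

lemma peval_psubst:
  fixes f :: "'v::finite cpoly"
  shows "peval x (psubst \<sigma> f) = peval (\<lambda>v. peval x (\<sigma> v)) f"
proof -
  have "(const (peval x (psubst \<sigma> f)) :: 'v cpoly) = psubst (\<lambda>v. const (x v)) (psubst \<sigma> f)"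
    by (simp only: psubst_const_eq_peval)
  also have "\<dots> = const (peval (\<lambda>v. peval x (\<sigma> v)) f)"
    by (subst psubst_psubst) (simp only: psubst_const_eq_peval)
  finally show ?thesis by simp
qed

lemma peval_var: "peval x (var v) = x v"
  using psubst_const_eq_peval[of x "var v"] by (simp add: psubst_var)

lemma peval_const: "peval x (const c) = c"
  using psubst_const_eq_peval[of x "const c"] by (simp add: psubst_const)

lemma peval_mult:
  fixes f g :: "'v::finite cpoly"
  shows "peval x (f * g) = peval x f * peval x g"
proof -
  have "(const (peval x (f * g)) :: 'v cpoly) = const (peval x f * peval x g)"
    by (simp only: psubst_const_eq_peval[symmetric] psubst_mult const_mult)
  then show ?thesis by simp
qed

lemma peval_diff:
  fixes f g :: "'v::finite cpoly"
  shows "peval x (f - g) = peval x f - peval x g"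
proof -
  have "(const (peval x (f - g)) :: 'v cpoly) = const (peval x f - peval x g)"
    by (simp only: psubst_const_eq_peval[symmetric] psubst_diff const_diff)
  then show ?thesis by simp
qed

lemma peval_sum:
  fixes h :: "'a \<Rightarrow> 'v::finite cpoly"
  shows "peval x (\<Sum>a\<in>S. h a) = (\<Sum>a\<in>S. peval x (h a))"
proof -
  have "(const (peval x (\<Sum>a\<in>S. h a)) :: 'v cpoly) = const (\<Sum>a\<in>S. peval x (h a))"
    by (simp only: psubst_const_eq_peval[symmetric] psubst_sum const_sum)
  then show ?thesis by simp
qed

lemma peval_alt:
  assumes "finite S" "Poly_Mapping.keys f \<subseteq> S"
  shows "peval x f =
    (\<Sum>m\<in>S. Poly_Mapping.lookup f m * (\<Prod>v\<in>UNIV. x v ^ Poly_Mapping.lookup m v))"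
  unfolding peval_def using assms
  by (intro sum.mono_neutral_left) (auto simp: in_keys_iff)

lemma var_power: "var v ^ n = Poly_Mapping.single (Poly_Mapping.single v n) 1"
  by (induction n) (simp_all add: var_def single_one mult_single flip: single_add)

lemma prod_single:
  "(\<Prod>a\<in>S. Poly_Mapping.single (h a) 1) = (Poly_Mapping.single (\<Sum>a\<in>S. h a) 1 :: 'v cpoly)"
  by (induction S rule: infinite_finite_induct) (simp_all add: single_one mult_single)

lemma monomial_eq_prod_var:
  "(\<Prod>v\<in>UNIV. var v ^ Poly_Mapping.lookup m v) = Poly_Mapping.single (m :: 'v::finite \<Rightarrow>\<^sub>0 nat) 1"
proof -
  have "(\<Sum>v\<in>UNIV. Poly_Mapping.single v (Poly_Mapping.lookup m v)) = m"
    by (rule poly_mapping_eqI) (simp add: lookup_sum lookup_single when_def)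
  then show ?thesis by (simp add: var_power prod_single)
qed

text \<open>Monomials are eigenvectors of a rescaling of the variables; this detects torus weights.\<close>

lemma lookup_psubst_scale:
  "Poly_Mapping.lookup (psubst (\<lambda>v. const (c v) * var v) f) m =
     Poly_Mapping.lookup f m * (\<Prod>v\<in>UNIV. c v ^ Poly_Mapping.lookup m v)"
proof (induction f rule: cpoly_induct)
  case (single n a)
  have "psubst (\<lambda>v. const (c v) * var v) (Poly_Mapping.single n a) =
      const (a * (\<Prod>v\<in>UNIV. c v ^ Poly_Mapping.lookup n v)) * Poly_Mapping.single n 1"
    by (simp only: psubst_single smult_cpoly_def power_mult_distrib prod.distrib
        monomial_eq_prod_var const_mult const_prod const_power mult.assoc)
  then show ?case
    by (simp add: mult_single lookup_single when_def)
qed (simp_all add: psubst_zero psubst_add lookup_add algebra_simps)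

section \<open>The action\<close>

text \<open>The triple sum that defines the action factors into three changes of basis.\<close>

lemma act_eq_psubst_mix:
  "act A B D = psubst (mix1 (\<lambda>p q. const (A $ p $ q)) (mix2 (\<lambda>p q. const (B $ p $ q))
     (mix3 (\<lambda>p q. const (D $ p $ q)) var)))"
  unfolding act_def
  by (rule arg_cong[where f = psubst])
    (simp add: mix1_def mix2_def mix3_def smult_cpoly_def sum_distrib_left const_mult mult.assoc)

lemma peval_act:
  "peval x (act A B D f) = peval (mix1 (\<lambda>p q. A $ p $ q) (mix2 (\<lambda>p q. B $ p $ q)
     (mix3 (\<lambda>p q. D $ p $ q) x))) f"
proof -
  have "peval x (mix1 (\<lambda>p q. const (A $ p $ q)) (mix2 (\<lambda>p q. const (B $ p $ q))
     (mix3 (\<lambda>p q. const (D $ p $ q)) var)) v) =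
     mix1 (\<lambda>p q. A $ p $ q) (mix2 (\<lambda>p q. B $ p $ q) (mix3 (\<lambda>p q. D $ p $ q) x)) v" for v
    by (cases v)
      (simp add: mix1_def mix2_def mix3_def peval_sum peval_mult peval_const peval_var)
  then show ?thesis
    by (simp add: act_eq_psubst_mix peval_psubst)
qed

lemma SL2_iff: "A \<in> SL2 \<longleftrightarrow> A $ 0 $ 0 * A $ 1 $ 1 - A $ 0 $ 1 * A $ 1 $ 0 = 1"
proof -
  have two: "(2 :: 2) = 0" by simp
  show ?thesis unfolding SL2_def det_2 two by (simp add: algebra_simps)
qed

lemma mat_1_in_SL2: "mat 1 \<in> SL2"
  by (simp add: SL2_def)

lemma mix_mat_1 [simp]:
  "mix1 (\<lambda>p q. (mat 1 :: 'a::comm_ring_1^2^2) $ p $ q) x = x"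
  "mix2 (\<lambda>p q. (mat 1 :: 'a::comm_ring_1^2^2) $ p $ q) x = x"
  "mix3 (\<lambda>p q. (mat 1 :: 'a::comm_ring_1^2^2) $ p $ q) x = x"
  by (auto intro!: array_eqI simp: mix1_def mix2_def mix3_def mat_def sum_2_01)

lemma peval_invariant:
  assumes "f \<in> invariants" "A \<in> SL2"
  shows "peval (mix1 (\<lambda>p q. A $ p $ q) x) f = peval x f"
    and "peval (mix2 (\<lambda>p q. A $ p $ q) x) f = peval x f"
    and "peval (mix3 (\<lambda>p q. A $ p $ q) x) f = peval x f"
  using peval_act[of x A "mat 1" "mat 1" f] peval_act[of x "mat 1" A "mat 1" f]
    peval_act[of x "mat 1" "mat 1" A f] assms mat_1_in_SL2
  by (simp_all add: invariants_def)

section \<open>The hyperdeterminant is an invariant of degree four\<close>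

lemma hyperdet_eq_form: "hyperdet = hyperdet_form var"
  by (simp add: hyperdet_def hyperdet_form_def)

lemma psubst_hyperdet: "psubst \<sigma> hyperdet = hyperdet_form \<sigma>"
  by (simp add: hyperdet_def hyperdet_form_def psubst_add psubst_diff psubst_mult psubst_power
      psubst_numeral psubst_var)

lemma hyperdet_invariant: "hyperdet \<in> invariants"
proof -
  have "act A B D hyperdet = hyperdet" if "A \<in> SL2" "B \<in> SL2" "D \<in> SL2" for A B D
  proof -
    have det: "const (M $ 0 $ 0) * const (M $ 1 $ 1) - const (M $ 0 $ 1) * const (M $ 1 $ 0) =
        (1 :: array_poly)" if "M \<in> SL2" for M
      using that by (simp add: SL2_iff single_one flip: const_mult const_diff)
    show ?thesis
      unfolding act_eq_psubst_mix psubst_hyperdet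
      using that by (simp add: det hyperdet_form_mix1 hyperdet_form_mix2 hyperdet_form_mix3
          hyperdet_eq_form)
  qed
  then show ?thesis by (simp add: invariants_def)
qed

lemma homogeneous_add: "f \<in> homogeneous d \<Longrightarrow> g \<in> homogeneous d \<Longrightarrow> f + g \<in> homogeneous d"
  using keys_add[of f g] by (auto simp: homogeneous_def)

lemma homogeneous_diff:
  fixes f g :: "'v::finite cpoly"
  shows "f \<in> homogeneous d \<Longrightarrow> g \<in> homogeneous d \<Longrightarrow> f - g \<in> homogeneous d"
  using keys_diff[of f g] by (auto simp: homogeneous_def)

lemma homogeneous_mult: "f \<in> homogeneous d \<Longrightarrow> g \<in> homogeneous e \<Longrightarrow> f * g \<in> homogeneous (d + e)"
  using keys_mult[of f g] by (fastforce simp: homogeneous_def lookup_add sum.distrib)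

lemma homogeneous_numeral: "numeral n \<in> homogeneous 0"
proof -
  have "(1 :: 'v::finite cpoly) \<in> homogeneous 0"
    by (simp add: homogeneous_def flip: single_one)
  then show ?thesis
    by (induction n) (auto simp only: numeral.simps intro: homogeneous_add[where d = 0])
qed

lemma homogeneous_var: "var v \<in> homogeneous 1"
  by (simp add: homogeneous_def var_def lookup_single when_def)

lemma hyperdet_homogeneous: "hyperdet \<in> homogeneous 4"
proof -
  have two: "var u * var v \<in> homogeneous 2" for u v :: "2 \<times> 2 \<times> 2"
    using homogeneous_mult[OF homogeneous_var homogeneous_var, of u v] by (simp add: numeral_2_eq_2)
  have four: "var u * var v * var w * var z \<in> homogeneous 4" for u v w z :: "2 \<times> 2 \<times> 2"
    using homogeneous_mult[OF two two, of u v w z] by (simp add: mult.assoc)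
  have square: "X a b c ^ 2 * X d e f ^ 2 \<in> homogeneous 4" for a b c d e f
    using homogeneous_mult[OF two two, of "(a, b, c)" "(a, b, c)" "(d, e, f)" "(d, e, f)"]
    by (simp add: power2_eq_square)
  have scaled: "numeral n * f \<in> homogeneous 4" if "f \<in> homogeneous 4" for n and f :: array_poly
    using homogeneous_mult[OF homogeneous_numeral that] by simp
  show ?thesis
    unfolding hyperdet_def by (intro homogeneous_add homogeneous_diff square scaled four)
qed

section \<open>Balanced monomials\<close>

text \<open>
  The exponents of degree 2 on each of the six faces of the cube, in the order: four squares of
  antipodal pairs, six products of two antipodal pairs, two inscribed tetrahedra. They are
  tabulated because quartics are expanded over this set term by term.
\<close>

definition balanced :: "(2 \<times> 2 \<times> 2 \<Rightarrow> nat) set" where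
  "balanced =
    {array 2 0 0 0 0 0 0 2, array 0 2 0 0 0 0 2 0, array 0 0 2 0 0 2 0 0, array 0 0 0 2 2 0 0 0,
     array 1 1 0 0 0 0 1 1, array 1 0 1 0 0 1 0 1, array 1 0 0 1 1 0 0 1,
     array 0 1 1 0 0 1 1 0, array 0 1 0 1 1 0 1 0, array 0 0 1 1 1 1 0 0,
     array 1 0 0 1 0 1 1 0, array 0 1 1 0 1 0 0 1}"

text \<open>
  The face equations leave four free parameters \<open>a, b, c, e\<close>, the exponents at a vertex and its three
  neighbours; nonnegativity of the other four exponents bounds them.
\<close>

lemma balanced_solutions:
  fixes a b c d e f g h :: nat
  assumes "a + b + c + d = 2" "e + f + g + h = 2" "a + b + e + f = 2" "c + d + g + h = 2"
    "a + c + e + g = 2" "b + d + f + h = 2"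
  shows "array a b c d e f g h \<in> balanced"
proof -
  have eqs: "d = 2 - (a + b + c)" "f = 2 - (a + b + e)" "g = 2 - (a + c + e)"
    "h = 2 * a + b + c + e - 2"
    using assms by linarith+
  have bounds: "a + b + c \<le> 2" "a + b + e \<le> 2" "a + c + e \<le> 2" "2 \<le> 2 * a + b + c + e"
    using assms by linarith+
  then have "(a, b, c, e) \<in> {0..2} \<times> {0..2} \<times> {0..2} \<times> {0..2}"
    by simp
  then have "(a, b, c, e) \<in>
    {(2,0,0,0), (1,1,0,0), (1,0,1,0), (1,0,0,1), (1,0,0,0), (0,2,0,0), (0,0,2,0), (0,0,0,2),
     (0,1,1,0), (0,1,0,1), (0,0,1,1), (0,1,1,1)}"
    using bounds by (simp add: numeral_2_eq_2 atLeastAtMostSuc_conv) (elim disjE; simp)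
  then show ?thesis
    unfolding eqs balanced_def
    by (simp only: insert_iff empty_iff prod.inject) (elim disjE conjE; simp)
qed

lemma two_power_eqD:
  assumes "(2 :: complex) ^ a * (1 / 2) ^ b = 1"
  shows "a = b"
proof -
  have "(2 :: complex) ^ a = 2 ^ b"
    using assms by (simp add: field_simps power_one_over)
  then have "of_nat (2 ^ a) = (of_nat (2 ^ b) :: complex)" by simp
  then show ?thesis by (simp only: of_nat_eq_iff) simp
qed

text \<open>
  One element of infinite order suffices to separate the weights of the one-parameter torus.
\<close>

definition torus :: "2 \<Rightarrow> complex" where
  "torus i = (if i = 0 then 2 else 1 / 2)"

definition diag :: "(2 \<Rightarrow> complex) \<Rightarrow> complex^2^2" where
  "diag s = (\<chi> p q. if p = q then s p else 0)"

lemma act_diag: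
  "act (diag r) (diag s) (diag t) = psubst (\<lambda>v. const (case v of (i, j, k) \<Rightarrow> r i * s j * t k) * var v)"
  unfolding act_eq_psubst_mix
  by (rule arg_cong[where f = psubst])
    (rule array_eqI; simp add: mix1_def mix2_def mix3_def diag_def sum_2_01 const_mult mult.assoc)

lemma invariant_weight:
  assumes "f \<in> invariants" "m \<in> Poly_Mapping.keys f"
    and "diag r \<in> SL2" "diag s \<in> SL2" "diag t \<in> SL2"
  shows "(\<Prod>v\<in>UNIV. (case v of (i, j, k) \<Rightarrow> r i * s j * t k) ^ Poly_Mapping.lookup m v) = 1"
proof -
  have "act (diag r) (diag s) (diag t) f = f"
    using assms by (simp add: invariants_def)
  then have "Poly_Mapping.lookup f m * (\<Prod>v\<in>UNIV. (case v of (i, j, k) \<Rightarrow> r i * s j * t k)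
      ^ Poly_Mapping.lookup m v) = Poly_Mapping.lookup f m"
    using lookup_psubst_scale[of "\<lambda>v. case v of (i, j, k) \<Rightarrow> r i * s j * t k" f m]
    by (simp add: act_diag)
  then show ?thesis
    using assms(2) by (simp add: in_keys_iff)
qed

text \<open>
  Applying the torus along one direction gives equal degrees on the two opposite faces; as the
  total degree is 4, each of these degrees is 2.
\<close>

lemma keys_invariant_balanced:
  assumes inv: "f \<in> invariants" and hom: "f \<in> homogeneous 4" and m: "m \<in> Poly_Mapping.keys f"
  shows "Poly_Mapping.lookup m \<in> balanced"
proof -
  define l where "l = Poly_Mapping.lookup m"
  have tor: "diag torus \<in> SL2" and one: "diag (\<lambda>_. 1) \<in> SL2"
    by (simp_all add: SL2_iff diag_def torus_def)
  have t: "torus 0 = 2" "torus 1 = 1 / 2"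
    by (simp_all add: torus_def)
  note w = invariant_weight[OF inv m, folded l_def]
  have "(2::complex) ^ (l (0,0,0) + l (0,0,1) + l (0,1,0) + l (0,1,1))
      * (1 / 2) ^ (l (1,0,0) + l (1,0,1) + l (1,1,0) + l (1,1,1)) = 1"
    using w[OF tor one one] by (simp add: prod_array prod_2_01 t power_add mult_ac)
  note e1 = two_power_eqD[OF this]
  have "(2::complex) ^ (l (0,0,0) + l (0,0,1) + l (1,0,0) + l (1,0,1))
      * (1 / 2) ^ (l (0,1,0) + l (0,1,1) + l (1,1,0) + l (1,1,1)) = 1"
    using w[OF one tor one] by (simp add: prod_array prod_2_01 t power_add mult_ac)
  note e2 = two_power_eqD[OF this]
  have "(2::complex) ^ (l (0,0,0) + l (0,1,0) + l (1,0,0) + l (1,1,0))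
      * (1 / 2) ^ (l (0,0,1) + l (0,1,1) + l (1,0,1) + l (1,1,1)) = 1"
    using w[OF one one tor] by (simp add: prod_array prod_2_01 t power_add mult_ac)
  note e3 = two_power_eqD[OF this]
  have "(\<Sum>v\<in>UNIV. l v) = 4"
    using hom m by (simp add: homogeneous_def l_def)
  then have e4: "l (0,0,0) + l (0,0,1) + l (0,1,0) + l (0,1,1)
      + l (1,0,0) + l (1,0,1) + l (1,1,0) + l (1,1,1) = 4"
    by (simp add: sum_array sum_2_01)
  have "array (l (0,0,0)) (l (0,0,1)) (l (0,1,0)) (l (0,1,1))
      (l (1,0,0)) (l (1,0,1)) (l (1,1,0)) (l (1,1,1)) \<in> balanced"
    using e1 e2 e3 e4 by (intro balanced_solutions) linarith+
  moreover have "array (l (0,0,0)) (l (0,0,1)) (l (0,1,0)) (l (0,1,1))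
      (l (1,0,0)) (l (1,0,1)) (l (1,1,0)) (l (1,1,1)) = l"
    by (rule array_eqI) simp_all
  ultimately show ?thesis by (simp add: l_def)
qed

abbreviation coeff_at :: "array_poly \<Rightarrow> (2 \<times> 2 \<times> 2 \<Rightarrow> nat) \<Rightarrow> complex" where
  "coeff_at f l \<equiv> Poly_Mapping.lookup f (Abs_poly_mapping l)"

lemma lookup_Abs_finite [simp]:
  "Poly_Mapping.lookup (Abs_poly_mapping l) = (l :: 'v::finite \<Rightarrow> nat)"
  by (rule lookup_Abs_poly_mapping) (rule finite)

lemma inj_Abs_poly_mapping: "inj_on (Abs_poly_mapping :: ('v::finite \<Rightarrow> nat) \<Rightarrow> _) S"
  by (rule inj_onI) (metis lookup_Abs_finite)

lemma peval_balanced: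
  assumes "f \<in> invariants" "f \<in> homogeneous 4"
  shows "peval x f = (\<Sum>l\<in>balanced. coeff_at f l * (\<Prod>v\<in>UNIV. x v ^ l v))"
proof -
  have "Poly_Mapping.keys f \<subseteq> Abs_poly_mapping ` balanced"
    using keys_invariant_balanced[OF assms] by (metis Poly_Mapping.lookup_inverse image_eqI subsetI)
  moreover have "finite balanced" by (simp add: balanced_def)
  ultimately show ?thesis
    by (subst peval_alt[of "Abs_poly_mapping ` balanced"])
      (simp_all add: sum.reindex inj_Abs_poly_mapping)
qed

lemma peval_balanced_explicit:
  assumes "f \<in> invariants" "f \<in> homogeneous 4"
  shows "peval (array x000 x001 x010 x011 x100 x101 x110 x111) f =
      coeff_at f (array 2 0 0 0 0 0 0 2) * x000^2 * x111^2
    + coeff_at f (array 0 2 0 0 0 0 2 0) * x001^2 * x110^2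
    + coeff_at f (array 0 0 2 0 0 2 0 0) * x010^2 * x101^2
    + coeff_at f (array 0 0 0 2 2 0 0 0) * x011^2 * x100^2
    + coeff_at f (array 1 1 0 0 0 0 1 1) * x000 * x001 * x110 * x111
    + coeff_at f (array 1 0 1 0 0 1 0 1) * x000 * x010 * x101 * x111
    + coeff_at f (array 1 0 0 1 1 0 0 1) * x000 * x011 * x100 * x111
    + coeff_at f (array 0 1 1 0 0 1 1 0) * x001 * x010 * x101 * x110
    + coeff_at f (array 0 1 0 1 1 0 1 0) * x001 * x011 * x100 * x110
    + coeff_at f (array 0 0 1 1 1 1 0 0) * x010 * x011 * x100 * x101
    + coeff_at f (array 1 0 0 1 0 1 1 0) * x000 * x011 * x101 * x110
    + coeff_at f (array 0 1 1 0 1 0 0 1) * x001 * x010 * x100 * x111"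
  unfolding peval_balanced[OF assms] balanced_def
  by (simp add: array_inject prod_array prod_2_01)

section \<open>Uniqueness\<close>

text \<open>
  Invariance under the unipotent matrix with columns \<open>(1, 0)\<close> and \<open>(1, 1)\<close>, along each direction: one
  face of the array is added to the opposite face.
\<close>

lemma peval_shear:
  assumes "f \<in> invariants"
  shows "peval (array a b c d (e + a) (f' + b) (g + c) (h + d)) f = peval (array a b c d e f' g h) f"
    and "peval (array a b (c + a) (d + b) e f' (g + e) (h + f')) f = peval (array a b c d e f' g h) f"
    and "peval (array a (b + a) c (d + c) e (f' + e) g (h + g)) f = peval (array a b c d e f' g h) f"
proof -
  define A :: "complex^2^2" where "A = (\<chi> p q. if p = 1 \<and> q = 0 then 0 else 1)"
  have A: "A \<in> SL2" by (simp add: SL2_iff A_def)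
  define x where "x = array a b c d e f' g h"
  have "mix1 (\<lambda>p q. A $ p $ q) x = array a b c d (e + a) (f' + b) (g + c) (h + d)"
    by (rule array_eqI) (simp_all add: mix1_def sum_2_01 A_def x_def)
  then show "peval (array a b c d (e + a) (f' + b) (g + c) (h + d)) f = peval (array a b c d e f' g h) f"
    using peval_invariant(1)[OF assms A, of x] by (simp add: x_def)
  have "mix2 (\<lambda>p q. A $ p $ q) x = array a b (c + a) (d + b) e f' (g + e) (h + f')"
    by (rule array_eqI) (simp_all add: mix2_def sum_2_01 A_def x_def)
  then show "peval (array a b (c + a) (d + b) e f' (g + e) (h + f')) f = peval (array a b c d e f' g h) f"
    using peval_invariant(2)[OF assms A, of x] by (simp add: x_def)
  have "mix3 (\<lambda>p q. A $ p $ q) x = array a (b + a) c (d + c) e (f' + e) g (h + g)"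
    by (rule array_eqI) (simp_all add: mix3_def sum_2_01 A_def x_def)
  then show "peval (array a (b + a) c (d + c) e (f' + e) g (h + g)) f = peval (array a b c d e f' g h) f"
    using peval_invariant(3)[OF assms A, of x] by (simp add: x_def)
qed

text \<open>
  The test arrays have few nonzero entries, so that only a few of the twelve monomials survive
  at the array and at its shear, and each comparison is a short linear relation. First come
  the squares and the products that involve the pair 000, 111, then the remaining products of
  two pairs, then the tetrahedra.
\<close>

lemma invariant_quartic_eq_0:
  assumes inv: "f \<in> invariants" and hom: "f \<in> homogeneous 4"
    and zero: "peval (array 1 0 0 0 0 0 0 1) f = 0"
  shows "f = 0"
proof -
  note ev = peval_balanced_explicit[OF inv hom]
  note sh = peval_shear[OF inv]
  have s0: "coeff_at f (array 2 0 0 0 0 0 0 2) = 0"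
    using zero by (simp add: ev)
  \<comment> \<open>A shear moves \<open>e\<^sub>0\<^sub>0\<^sub>0 + e\<^sub>0\<^sub>1\<^sub>1 + r e\<^sub>1\<^sub>1\<^sub>1\<close> to \<open>e\<^sub>0\<^sub>0\<^sub>0 + e\<^sub>0\<^sub>1\<^sub>1 + e\<^sub>1\<^sub>0\<^sub>0 + (r + 1) e\<^sub>1\<^sub>1\<^sub>1\<close>; the values
    \<open>r = 0\<close> and \<open>r = 1\<close> give two independent relations for two unknown coefficients.
    The other directions are analogous.\<close>
  have "coeff_at f (array 0 0 0 2 2 0 0 0) + coeff_at f (array 1 0 0 1 1 0 0 1) = 0"
    using sh(1)[of 1 0 0 1 0 0 0 0] by (simp add: ev s0)
  moreover have "coeff_at f (array 0 0 0 2 2 0 0 0) + 2 * coeff_at f (array 1 0 0 1 1 0 0 1) = 0"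
    using sh(1)[of 1 0 0 1 0 0 0 1] by (simp add: ev s0 mult.commute)
  ultimately have r1: "coeff_at f (array 0 0 0 2 2 0 0 0) = 0" "coeff_at f (array 1 0 0 1 1 0 0 1) = 0"
    by algebra+
  have "coeff_at f (array 0 0 2 0 0 2 0 0) + coeff_at f (array 1 0 1 0 0 1 0 1) = 0"
    using sh(2)[of 1 0 0 0 0 1 0 0] by (simp add: ev s0)
  moreover have "coeff_at f (array 0 0 2 0 0 2 0 0) + 2 * coeff_at f (array 1 0 1 0 0 1 0 1) = 0"
    using sh(2)[of 1 0 0 0 0 1 0 1] by (simp add: ev s0 mult.commute)
  ultimately have r2: "coeff_at f (array 0 0 2 0 0 2 0 0) = 0" "coeff_at f (array 1 0 1 0 0 1 0 1) = 0"
    by algebra+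
  have "coeff_at f (array 0 2 0 0 0 0 2 0) + coeff_at f (array 1 1 0 0 0 0 1 1) = 0"
    using sh(3)[of 1 0 0 0 0 0 1 0] by (simp add: ev s0)
  moreover have "coeff_at f (array 0 2 0 0 0 0 2 0) + 2 * coeff_at f (array 1 1 0 0 0 0 1 1) = 0"
    using sh(3)[of 1 0 0 0 0 0 1 1] by (simp add: ev s0 mult.commute)
  ultimately have r3: "coeff_at f (array 0 2 0 0 0 0 2 0) = 0" "coeff_at f (array 1 1 0 0 0 0 1 1) = 0"
    by algebra+
  note z = s0 r1 r2 r3
  \<comment> \<open>The shear of the sum of two opposite vertices of a face has four entries 1, which are two
    antipodal pairs whose squares are already known to have coefficient zero.\<close>
  have t1: "coeff_at f (array 0 1 1 0 0 1 1 0) = 0"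
    using sh(1)[of 0 1 1 0 0 0 0 0] by (simp add: ev z)
  have t2: "coeff_at f (array 0 1 0 1 1 0 1 0) = 0"
    using sh(2)[of 0 1 0 0 1 0 0 0] by (simp add: ev z)
  have t3: "coeff_at f (array 0 0 1 1 1 1 0 0) = 0"
    using sh(3)[of 0 0 1 0 1 0 0 0] by (simp add: ev z)
  \<comment> \<open>Each test array contains three vertices of a tetrahedron and the vertex that the shear
    moves to the fourth.\<close>
  have u1: "coeff_at f (array 0 1 1 0 1 0 0 1) = 0"
    using sh(1)[of 1 1 1 0 0 0 0 1] by (simp add: ev z t1 t2 t3 del: One_nat_def)
  have u2: "coeff_at f (array 1 0 0 1 0 1 1 0) = 0"
    using sh(1)[of 1 1 0 1 0 0 1 0] by (simp add: ev z t1 t2 t3 del: One_nat_def)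
  have "coeff_at f l = 0" if "l \<in> balanced" for l
    using that z t1 t2 t3 u1 u2 unfolding balanced_def by blast
  then have "Poly_Mapping.keys f = {}"
    using keys_invariant_balanced[OF inv hom]
    by (metis Poly_Mapping.lookup_inverse in_keys_iff equals0I)
  then show ?thesis by simp
qed

section \<open>The space of invariant quartics\<close>

theorem theorem29:
  "cpoly.dim (invariants \<inter> homogeneous 4) = 1 \<and>
   (\<forall>f \<in> invariants \<inter> homogeneous 4. \<exists>c. f = smult_cpoly c hyperdet)"
proof -
  let ?p = "array 1 0 0 0 0 0 0 1 :: 2 \<times> 2 \<times> 2 \<Rightarrow> complex"
  let ?V = "invariants \<inter> homogeneous 4 :: array_poly set"
  have C: "hyperdet \<in> ?V"
    using hyperdet_invariant hyperdet_homogeneous by blast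
  have C1: "peval ?p hyperdet = 1"
  proof -
    have "psubst (\<lambda>v. const (?p v)) hyperdet = (1 :: array_poly)"
      by (simp add: psubst_hyperdet hyperdet_form_def single_one)
    then have "const (peval ?p hyperdet) = (const 1 :: array_poly)"
      by (simp only: psubst_const_eq_peval single_one)
    then show ?thesis by (simp only: const_inject)
  qed
  have uniq: "f = smult_cpoly (peval ?p f) hyperdet" if f: "f \<in> ?V" for f
  proof -
    let ?g = "f - smult_cpoly (peval ?p f) hyperdet"
    have "?g \<in> ?V"
      using subspace_invariants_homogeneous f C
      by (meson cpoly.subspace_diff cpoly.subspace_scale)
    moreover have "peval ?p ?g = 0"
      by (simp add: peval_diff smult_cpoly_def peval_mult peval_const C1)
    ultimately have "?g = 0"
      using invariant_quartic_eq_0 by blast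
    then show ?thesis by simp
  qed
  have "?V = cpoly.span {hyperdet}"
  proof
    show "?V \<subseteq> cpoly.span {hyperdet}"
      unfolding cpoly.span_singleton using uniq by blast
    show "cpoly.span {hyperdet} \<subseteq> ?V"
      using C subspace_invariants_homogeneous by (intro cpoly.span_minimal) auto
  qed
  moreover have "hyperdet \<noteq> 0"
    using C1 by (auto simp: peval_def)
  then have "cpoly.dim (cpoly.span {hyperdet}) = 1"
    by (subst cpoly.dim_span_eq_card_independent) simp_all
  ultimately have "cpoly.dim ?V = 1"
    by simp
  then show ?thesis
    using uniq by blast
qed

end
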